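(* Let $t\ge 2$ be an integer and let $n=T_t+1$, where $T_t=\frac{t(t+1)}{2}$. Then \[ \Delta_n=t(t-1)+1, \] and \[ \operatorname{MaxDeg}(n)=\{\delta_t^{\mathrm{top}},\delta_t^{\mathrm{bot}}\}, \] where $\delta_t^{\mathrm{top}}=(t+1,t-1,t-2,\dots,2,1)$ and $\delta_t^{\mathrm{bot}}=(t,t-1,\dots,2,1,1)$. In particular, $m_\Delta(T_t+1)=2$.
   Context: A partition $\lambda\vdash n$ is a finite nonincreasing sequence of positive integers with sum $n$. The partition graph $G_n$ ($n\ge 1$) is the simple graph whose vertices are the partitions of $n$; two distinct partitions are adjacent if one is obtained from the other by an elementary transfer of one unit between two parts, followed by reordering: one part is decreased by $1$ and another part is increased by $1$. Here the receiving part may be an empty part of size $0$ (so that a new part $1$ is created), and a part that becomes $0$ is discarded. $\deg(\lambda)$ denotes the degree of the vertex $\lambda$ in $G_n$, $\Delta_n:=\max_{\lambda\vdash n}\deg(\lambda)$, $\operatorname{MaxDeg}(n):=\{\lambda\vdash n:\deg(\lambda)=\Delta_n\}$, and $m_\Delta(n):=|\operatorname{MaxDeg}(n)|$. The partition $\delta_t^{\mathrm{top}}$ is obtained from the staircase $(t,t-1,\dots,1)$ by increasing the largest part by $1$, and $\delta_t^{\mathrm{bot}}$ by adjoining one additional part equal to $1$ (for $t=2$ these are $(3,1)$ and $(2,1,1)$). *)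

theory Defs
  imports Main
begin

text \<open>A partition of \<open>n\<close>: a nonincreasing list of positive integers with sum \<open>n\<close>.\<close>

definition partitions :: "nat \<Rightarrow> nat list set" where
  "partitions n = {xs. sorted_wrt (\<ge>) xs \<and> (\<forall>x\<in>set xs. 0 < x) \<and> sum_list xs = n}"

text \<open>Discard the empty parts and reorder nonincreasingly.\<close>

definition normalize_parts :: "nat list \<Rightarrow> nat list" where
  "normalize_parts xs = rev (sort (filter (\<lambda>x. 0 < x) xs))"

text \<open>
  The list \<open>zs\<close> below is \<open>xs\<close> with one empty part appended, which may serve as the
  receiving part \<open>j\<close>; the condition \<open>0 < zs ! i\<close> excludes it as the giving part \<open>i\<close>
  (and keeps the subtraction on \<open>nat\<close> from truncating).
\<close>

definition elementary_transfer :: "nat list \<Rightarrow> nat list \<Rightarrow> bool" where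
  "elementary_transfer xs ys \<longleftrightarrow>
     (let zs = xs @ [0] in
      \<exists>i < length zs. \<exists>j < length zs. i \<noteq> j \<and> 0 < zs ! i \<and>
        ys = normalize_parts (zs[i := zs ! i - 1, j := zs ! j + 1]))"

text \<open>The partition graph \<open>G\<^sub>n\<close> has vertex set \<open>partitions n\<close> and the following adjacency.\<close>

definition partition_adj :: "nat \<Rightarrow> nat list \<Rightarrow> nat list \<Rightarrow> bool" where
  "partition_adj n xs ys \<longleftrightarrow>
     xs \<in> partitions n \<and> ys \<in> partitions n \<and> xs \<noteq> ys \<and>
     (elementary_transfer xs ys \<or> elementary_transfer ys xs)"

definition partition_deg :: "nat \<Rightarrow> nat list \<Rightarrow> nat" where
  "partition_deg n xs = card {ys. partition_adj n xs ys}"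

definition max_partition_deg :: "nat \<Rightarrow> nat" where
  "max_partition_deg n = Max (partition_deg n ` partitions n)"

definition MaxDeg :: "nat \<Rightarrow> nat list set" where
  "MaxDeg n = {xs \<in> partitions n. partition_deg n xs = max_partition_deg n}"

definition m_Delta :: "nat \<Rightarrow> nat" where
  "m_Delta n = card (MaxDeg n)"

definition triangular :: "nat \<Rightarrow> nat" where
  "triangular t = t * (t + 1) div 2"

definition staircase :: "nat \<Rightarrow> nat list" where
  "staircase t = rev [1..<t + 1]"

definition delta_top :: "nat \<Rightarrow> nat list" where
  "delta_top t = (staircase t)[0 := staircase t ! 0 + 1]"

definition delta_bot :: "nat \<Rightarrow> nat list" where
  "delta_bot t = staircase t @ [1]"

lemma delta_top_eq: "1 \<le> t \<Longrightarrow> delta_top t = (t + 1) # rev [1..<t]"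
  by (simp add: delta_top_def staircase_def)

lemma delta_bot_eq: "delta_bot t = rev [1..<t + 1] @ [1]"
  by (simp add: delta_bot_def staircase_def)

text \<open>
  The set of vertices is finite and nonempty, so \<open>Max\<close> and \<open>card\<close> above have
  their intended meaning.
\<close>

lemma finite_partitions: "finite (partitions n)"
proof (rule finite_subset)
  have len: "length xs \<le> sum_list xs" if "\<forall>x\<in>set xs. 0 < x" for xs :: "nat list"
    using that by (induction xs) auto
  show "partitions n \<subseteq> {xs. set xs \<subseteq> {..n} \<and> length xs \<le> n}"
    using len by (auto simp: partitions_def dest: member_le_sum_list)
  show "finite {xs. set xs \<subseteq> {..n} \<and> length xs \<le> n}"
    by (rule finite_lists_length_le) simp
qed

lemma partitions_nonempty: "partitions n \<noteq> {}"
proof -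
  have "replicate n 1 \<in> partitions n"
    by (auto simp: partitions_def sorted_wrt_iff_nth_less sum_list_replicate)
  then show ?thesis by blast
qed

lemma finite_neighbours: "finite {ys. partition_adj n xs ys}"
  by (rule finite_subset[OF _ finite_partitions[of n]]) (auto simp: partition_adj_def)

end

theory Submission
  imports Defs "HOL-Library.Multiset"
begin

text \<open>
  Let \<open>N\<^sub>v\<close> be the number of parts of a partition that are at least \<open>v\<close>; the numbers \<open>N\<^sub>v\<close> with
  \<open>v \<ge> 1\<close> (the conjugate partition) determine the partition. Moving a unit from a part of size \<open>a\<close>
  to a part of size \<open>b\<close>, where \<open>b = 0\<close> stands for the empty part, lowers \<open>N\<^sub>a\<close> by one, raises
  \<open>N\<close> at \<open>b + 1\<close> by one, and changes nothing else. Hence the transfer does nothing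
  exactly if \<open>a = b + 1\<close>, and otherwise the result determines \<open>a\<close> and \<open>b\<close>. So, with \<open>D\<close> the set of
  part sizes of a partition, its degree is the number of pairs \<open>(a, b)\<close> in \<open>D \<times> (D \<union> {0})\<close> such
  that \<open>a \<noteq> b + 1\<close> and such that \<open>a\<close> is repeated if \<open>a = b\<close>
  (\<open>partition_deg_eq_card_transfer_pairs\<close>).

  In particular the degree is at most \<open>d (d + 1)\<close> for \<open>d = |D|\<close>, which is less than
  \<open>t (t - 1) + 1\<close> whenever \<open>d < t\<close>. It remains to consider \<open>d \<ge> t\<close>. Since \<open>d\<close> distinct positive
  integers have sum at least \<open>T\<^sub>d\<close>, a partition of \<open>T\<^sub>t + 1\<close> with \<open>d \<ge> t\<close> has \<open>d = t\<close> and only one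
  unit to spare above the staircase: either \<open>D = {1, \<dots>, t}\<close> and there is one further part \<open>1\<close>, or
  \<open>D = {1, \<dots>, t - 1, t + 1}\<close> and no part is repeated (\<open>card_set_less_or_delta\<close>). These are the two
  partitions of the theorem, and counting their pairs gives \<open>t (t - 1) + 1\<close> in both cases.
\<close>

section \<open>Counting parts by size\<close>

text \<open>
  The number of parts of size at least \<open>v\<close>. For \<open>v \<ge> 1\<close> empty parts do not count, so these numbers
  are unaffected by normalization.
\<close>

definition parts_ge :: "nat list \<Rightarrow> nat \<Rightarrow> nat" where
  "parts_ge xs v = length (filter (\<lambda>x. v \<le> x) xs)"

lemma parts_ge_eq_count: "parts_ge xs v = count (mset xs) v + parts_ge xs (Suc v)"
  by (induction xs) (auto simp: parts_ge_def)

lemma parts_ge_append_zero: "1 \<le> v \<Longrightarrow> parts_ge (xs @ [0]) v = parts_ge xs v"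
  by (simp add: parts_ge_def)

lemma parts_ge_list_update:
  "i < length xs \<Longrightarrow>
     int (parts_ge (xs[i := x]) v) =
     int (parts_ge xs v) - of_bool (v \<le> xs ! i) + of_bool (v \<le> x)"
proof (induction xs arbitrary: i)
  case Nil
  then show ?case by simp
next
  case (Cons y xs)
  have *: "parts_ge (y # zs) v = of_bool (v \<le> y) + parts_ge zs v" for y zs
    by (simp add: parts_ge_def)
  show ?case
  proof (cases i)
    case 0
    then show ?thesis by (simp add: *)
  next
    case (Suc k)
    then show ?thesis using Cons.IH[of k] Cons.prems by (simp add: *)
  qed
qed

lemma mset_normalize_parts: "mset (normalize_parts xs) = filter_mset (\<lambda>x. 0 < x) (mset xs)"
  by (simp add: normalize_parts_def)

lemma parts_ge_mset: "parts_ge xs v = size (filter_mset (\<lambda>x. v \<le> x) (mset xs))"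
  by (simp add: parts_ge_def flip: mset_filter)

lemma parts_ge_normalize_parts:
  assumes "1 \<le> v"
  shows "parts_ge (normalize_parts xs) v = parts_ge xs v"
proof -
  have "(\<lambda>x. v \<le> x \<and> 0 < x) = (\<lambda>x. v \<le> x)"
    using assms by auto
  then show ?thesis
    by (simp add: parts_ge_mset mset_normalize_parts filter_filter_mset conj_commute)
qed

lemma normalize_parts_in_partitions: "normalize_parts xs \<in> partitions (sum_list xs)"
proof -
  have "sum_list (filter (\<lambda>x. 0 < x) xs) = sum_list xs"
    by (induction xs) auto
  then have "sum_mset (filter_mset (\<lambda>x. 0 < x) (mset xs)) = sum_list xs"
    by (simp add: sum_mset_sum_list flip: mset_filter)
  then have "sum_list (normalize_parts xs) = sum_list xs"
    by (metis mset_normalize_parts sum_mset_sum_list)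
  moreover have "sorted_wrt (\<ge>) (normalize_parts xs)"
    by (simp add: normalize_parts_def sorted_wrt_rev)
  moreover have "\<forall>x\<in>set (normalize_parts xs). 0 < x"
    by (simp add: normalize_parts_def)
  ultimately show ?thesis
    by (simp add: partitions_def)
qed

lemma partition_eqI_mset:
  assumes "xs \<in> partitions n" "ys \<in> partitions m" "mset xs = mset ys"
  shows "xs = ys"
proof -
  have "sorted (rev xs)" "sorted (rev ys)"
    using assms(1,2) by (simp_all add: partitions_def sorted_wrt_rev)
  then have "rev xs = rev ys"
    using assms(3) by (metis mset_rev properties_for_sort)
  then show ?thesis by simp
qed

lemma partition_eqI_parts_ge:
  assumes "xs \<in> partitions n" "ys \<in> partitions m"
    and "\<And>v. 1 \<le> v \<Longrightarrow> parts_ge xs v = parts_ge ys v"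
  shows "xs = ys"
proof (rule partition_eqI_mset[OF assms(1,2)], rule multiset_eqI)
  fix v
  show "count (mset xs) v = count (mset ys) v"
  proof (cases "v = 0")
    case True
    then have "v \<notin># mset xs" "v \<notin># mset ys"
      using assms(1,2) by (auto simp: partitions_def)
    then show ?thesis by (metis not_in_iff)
  next
    case False
    then show ?thesis
      using parts_ge_eq_count[of xs v] parts_ge_eq_count[of ys v] assms(3)[of v] assms(3)[of "Suc v"]
      by simp
  qed
qed

section \<open>Neighbours as pairs of part sizes\<close>

text \<open>
  The partition \<open>ys\<close> arises from \<open>xs\<close> by moving a unit from a part of size \<open>a\<close> to one of size \<open>b\<close>,
  expressed through the numbers of parts of size at least \<open>v\<close>. That parts of these sizes exist is
  not required; for \<open>1 \<le> a\<close> and \<open>a \<noteq> Suc b\<close> it follows (\<open>unit_shift_imp_transfer_pair\<close>).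
\<close>

definition unit_shift :: "nat list \<Rightarrow> nat \<Rightarrow> nat \<Rightarrow> nat list \<Rightarrow> bool" where
  "unit_shift xs a b ys \<longleftrightarrow>
     (\<forall>v\<ge>1. int (parts_ge ys v) = int (parts_ge xs v) - of_bool (v = a) + of_bool (v = Suc b))"

lemma unit_shift_sym:
  assumes "1 \<le> a" "unit_shift xs a b ys"
  shows "unit_shift ys (Suc b) (a - 1) xs"
  unfolding unit_shift_def
proof (intro allI impI)
  fix v :: nat
  assume "1 \<le> v"
  moreover have "v = Suc (a - 1) \<longleftrightarrow> v = a"
    using assms(1) by auto
  ultimately show "int (parts_ge xs v) =
      int (parts_ge ys v) - of_bool (v = Suc b) + of_bool (v = Suc (a - 1))"
    using assms(2) by (simp add: unit_shift_def)
qed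

lemma unit_shift_unique:
  assumes "unit_shift xs a b ys" "unit_shift xs c d ys"
    and "1 \<le> a" "1 \<le> c" "a \<noteq> Suc b" "c \<noteq> Suc d"
  shows "a = c \<and> b = d"
proof -
  have eq: "of_bool (v = Suc b) - of_bool (v = a) = (of_bool (v = Suc d) - of_bool (v = c) :: int)"
    if "1 \<le> v" for v
  proof -
    have "int (parts_ge ys v) = int (parts_ge xs v) - of_bool (v = a) + of_bool (v = Suc b)"
      "int (parts_ge ys v) = int (parts_ge xs v) - of_bool (v = c) + of_bool (v = Suc d)"
      using assms(1,2) that unfolding unit_shift_def by blast+
    then show ?thesis by linarith
  qed
  show ?thesis
    using eq[of a] eq[of "Suc b"] assms(3-) by (auto simp: of_bool_def split: if_splits)
qed

text \<open>An elementary transfer, in terms of the sizes of the two parts involved.\<close>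

lemma unit_shift_list_update:
  assumes "i < length zs" "j < length zs" "i \<noteq> j" "0 < zs ! i"
    and zs: "zs = xs @ [0]"
  shows "unit_shift xs (zs ! i) (zs ! j) (normalize_parts (zs[i := zs ! i - 1, j := zs ! j + 1]))"
  unfolding unit_shift_def
proof (intro allI impI)
  fix v :: nat
  assume v: "1 \<le> v"
  have "int (parts_ge (zs[i := zs ! i - 1, j := zs ! j + 1]) v) =
      int (parts_ge zs v) - of_bool (v \<le> zs ! i) + of_bool (v \<le> zs ! i - 1)
        - of_bool (v \<le> zs ! j) + of_bool (v \<le> zs ! j + 1)"
    using assms(1-3) by (simp add: parts_ge_list_update)
  also have "\<dots> = int (parts_ge zs v) - of_bool (v = zs ! i) + of_bool (v = Suc (zs ! j))"
    using assms(4) by (auto simp: of_bool_def)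
  finally show "int (parts_ge (normalize_parts (zs[i := zs ! i - 1, j := zs ! j + 1])) v) =
      int (parts_ge xs v) - of_bool (v = zs ! i) + of_bool (v = Suc (zs ! j))"
    using v parts_ge_append_zero[OF v, of xs] by (simp add: parts_ge_normalize_parts zs)
qed

text \<open>
  The pairs of a giving size \<open>a\<close> and a receiving size \<open>b\<close> for which a transfer exists and changes the
  partition. The receiving size \<open>0\<close> is that of the empty part, and \<open>a = Suc b\<close> would only exchange
  the two parts.
\<close>

definition transfer_pairs :: "nat list \<Rightarrow> (nat \<times> nat) set" where
  "transfer_pairs xs = {(a, b). a \<in> set xs \<and> b \<in> insert 0 (set xs) \<and> a \<noteq> Suc b \<and>
     (a = b \<longrightarrow> 2 \<le> count (mset xs) a)}"

text \<open>
  For every list \<open>ys\<close> the number of parts of size at least \<open>v\<close> is nonincreasing in \<open>v\<close>. Lowering it at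
  \<open>a\<close> and raising it at \<open>Suc b\<close> is therefore possible only if \<open>xs\<close> has enough parts of the sizes \<open>a\<close>
  and \<open>b\<close>.
\<close>

lemma unit_shift_imp_transfer_pair:
  assumes "unit_shift xs a b ys" "1 \<le> a" "a \<noteq> Suc b"
  shows "(a, b) \<in> transfer_pairs xs"
proof -
  have eq: "int (parts_ge ys v) = int (parts_ge xs v) - of_bool (v = a) + of_bool (v = Suc b)"
    if "1 \<le> v" for v
    using assms(1) that by (simp add: unit_shift_def)
  have mono: "parts_ge ys (Suc v) \<le> parts_ge ys v" for v
    using parts_ge_eq_count[of ys v] by simp
  have a: "1 + of_bool (a = b) \<le> int (count (mset xs) a)"
    using mono[of a] eq[of a] eq[of "Suc a"] parts_ge_eq_count[of xs a] assms(2,3)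
    by (auto simp: of_bool_def split: if_splits)
  have "1 \<le> count (mset xs) b" if "b \<noteq> 0"
  proof -
    have "1 \<le> b" using that by simp
    then show ?thesis
      using mono[of b] eq[of b] eq[of "Suc b"] parts_ge_eq_count[of xs b] assms(3)
      by (cases "b = a"; simp del: count_greater_eq_one_iff count_greater_eq_Suc_zero_iff)
  qed
  then have "b \<in> insert 0 (set xs)"
    by (auto simp: Suc_le_eq)
  moreover have "a \<in> set xs"
  proof (rule ccontr)
    assume "a \<notin> set xs"
    then have "count (mset xs) a = 0"
      by (metis not_in_iff set_mset_mset)
    with a show False by (simp add: of_bool_def split: if_splits)
  qed
  moreover have "a = b \<longrightarrow> 2 \<le> count (mset xs) a"
    using a by auto
  ultimately show ?thesis
    using assms(3) by (simp add: transfer_pairs_def)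
qed

lemma elementary_transfer_imp_unit_shift:
  assumes "elementary_transfer xs ys"
  obtains a b where "1 \<le> a" "unit_shift xs a b ys"
proof -
  define zs where "zs = xs @ [0]"
  obtain i j where ij: "i < length zs" "j < length zs" "i \<noteq> j" "0 < zs ! i"
    "ys = normalize_parts (zs[i := zs ! i - 1, j := zs ! j + 1])"
    using assms unfolding elementary_transfer_def Let_def zs_def by blast
  show ?thesis
    using that[of "zs ! i" "zs ! j"] unit_shift_list_update[OF ij(1-4) zs_def] ij(4,5) by simp
qed

text \<open>
  Adjacency allows a transfer in either direction, but a transfer back from \<open>ys\<close> to \<open>xs\<close> is also a
  unit shift from \<open>xs\<close> to \<open>ys\<close>, so no further neighbours arise.
\<close>

lemma partition_adj_imp_transfer_pair:
  assumes "partition_adj n xs ys"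
  shows "\<exists>(a, b)\<in>transfer_pairs xs. unit_shift xs a b ys"
proof -
  have part: "xs \<in> partitions n" "ys \<in> partitions n" "xs \<noteq> ys"
    using assms by (auto simp: partition_adj_def)
  obtain a b where ab: "1 \<le> a" "unit_shift xs a b ys"
  proof (cases "elementary_transfer xs ys")
    case True
    then show ?thesis using that elementary_transfer_imp_unit_shift by blast
  next
    case False
    then obtain a b where "1 \<le> a" "unit_shift ys a b xs"
      using assms elementary_transfer_imp_unit_shift[of ys xs] by (auto simp: partition_adj_def)
    then show ?thesis using that[of "Suc b" "a - 1"] unit_shift_sym by simp
  qed
  have "a \<noteq> Suc b"
  proof
    assume "a = Suc b"
    then have "xs = ys"
      using ab(2) by (intro partition_eqI_parts_ge[OF part(1,2)]) (simp add: unit_shift_def)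
    with part(3) show False by simp
  qed
  with ab show ?thesis
    using unit_shift_imp_transfer_pair by blast
qed

lemma count_ge_2_imp_two_indices:
  assumes "2 \<le> count (mset xs) a"
  obtains i j where "i < length xs" "j < length xs" "i \<noteq> j" "xs ! i = a" "xs ! j = a"
proof -
  let ?I = "{i. i < length xs \<and> xs ! i = a}"
  have "count (mset xs) a = card ?I"
    by (simp add: count_mset count_list_eq_length_filter length_filter_conv_card eq_commute)
  then have "\<exists>i\<in>?I. \<exists>j\<in>?I. i \<noteq> j"
    using assms card_le_Suc0_iff_eq[of ?I] by fastforce
  then show ?thesis using that by blast
qed

lemma sum_list_transfer:
  fixes xs :: "nat list"
  assumes "i < length xs" "j < length xs" "i \<noteq> j" "0 < xs ! i"
  shows "sum_list (xs[i := xs ! i - 1, j := xs ! j + 1]) = sum_list xs"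
proof -
  have upd: "sum_list (zs[k := x]) + zs ! k = sum_list zs + x"
    if "k < length zs" for zs :: "nat list" and k x
    using that elem_le_sum_list[of k zs] by (simp add: sum_list_update)
  have "sum_list (xs[i := xs ! i - 1, j := xs ! j + 1]) + xs ! j
      = sum_list (xs[i := xs ! i - 1]) + (xs ! j + 1)"
    using upd[of j "xs[i := xs ! i - 1]" "xs ! j + 1"] assms(2,3) by simp
  then show ?thesis
    using upd[OF assms(1), of "xs ! i - 1"] assms(4) by linarith
qed

lemma transfer_pair_imp_partition_adj:
  assumes xs: "xs \<in> partitions n" and ab: "(a, b) \<in> transfer_pairs xs"
  shows "\<exists>ys. partition_adj n xs ys \<and> unit_shift xs a b ys"
proof -
  define zs where "zs = xs @ [0]"
  have a: "a \<in> set xs" "0 < a" and b: "b \<in> insert 0 (set xs)" and ne: "a \<noteq> Suc b"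
    and eq: "a = b \<longrightarrow> 2 \<le> count (mset xs) a"
    using ab xs by (auto simp: transfer_pairs_def partitions_def)
  have "\<exists>i < length zs. \<exists>j < length zs. i \<noteq> j \<and> zs ! i = a \<and> zs ! j = b"
  proof (cases "a = b")
    case True
    then have "2 \<le> count (mset zs) a"
      using eq a(2) by (simp add: zs_def)
    then show ?thesis
      using True by (metis count_ge_2_imp_two_indices)
  next
    case False
    have "a \<in> set zs" "b \<in> set zs"
      using a b by (auto simp: zs_def)
    with False show ?thesis
      by (metis in_set_conv_nth)
  qed
  then obtain i j where ij: "i < length zs" "j < length zs" "i \<noteq> j" "zs ! i = a" "zs ! j = b"
    by blast
  define us where "us = zs[i := zs ! i - 1, j := zs ! j + 1]"
  define ys where "ys = normalize_parts us"
  have shift: "unit_shift xs a b ys"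
    using unit_shift_list_update[OF ij(1-3) _ zs_def] a(2) ij(4,5) by (simp add: ys_def us_def)
  have tr: "elementary_transfer xs ys"
    unfolding elementary_transfer_def Let_def zs_def[symmetric]
    using ij a(2) by (intro exI[of _ i] exI[of _ j] conjI) (simp_all add: ys_def us_def)
  have "sum_list us = sum_list zs"
    unfolding us_def using ij a(2) by (intro sum_list_transfer) auto
  then have ys: "ys \<in> partitions n"
    using normalize_parts_in_partitions[of us] xs by (simp add: ys_def zs_def partitions_def)
  have "int (parts_ge ys a) \<noteq> int (parts_ge xs a)"
    using shift a(2) ne by (simp add: unit_shift_def)
  then have "xs \<noteq> ys" by auto
  then show ?thesis
    using shift tr xs ys by (auto simp: partition_adj_def)
qed

lemma partition_deg_eq_card_transfer_pairs:
  assumes xs: "xs \<in> partitions n"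
  shows "partition_deg n xs = card (transfer_pairs xs)"
proof -
  let ?N = "{ys. partition_adj n xs ys}"
  have "\<forall>p\<in>transfer_pairs xs. \<exists>ys. partition_adj n xs ys \<and> unit_shift xs (fst p) (snd p) ys"
    using transfer_pair_imp_partition_adj[OF xs] by auto
  then obtain f where f: "\<And>p. p \<in> transfer_pairs xs \<Longrightarrow>
      partition_adj n xs (f p) \<and> unit_shift xs (fst p) (snd p) (f p)"
    by metis
  have pos: "1 \<le> fst p" "fst p \<noteq> Suc (snd p)" if "p \<in> transfer_pairs xs" for p
    using that xs by (auto simp: transfer_pairs_def partitions_def Suc_le_eq)
  have "inj_on f (transfer_pairs xs)"
  proof (rule inj_onI)
    fix p q
    assume "p \<in> transfer_pairs xs" "q \<in> transfer_pairs xs" "f p = f q"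
    then show "p = q"
      using unit_shift_unique[of xs "fst p" "snd p" "f p" "fst q" "snd q"] f pos
      by (metis prod.expand)
  qed
  moreover have "f ` transfer_pairs xs = ?N"
  proof (intro equalityI subsetI)
    fix ys
    assume "ys \<in> ?N"
    then have adj: "partition_adj n xs ys" by simp
    then obtain p where p: "p \<in> transfer_pairs xs" "unit_shift xs (fst p) (snd p) ys"
      using partition_adj_imp_transfer_pair by fastforce
    have "ys = f p"
    proof (rule partition_eqI_parts_ge)
      show "ys \<in> partitions n" "f p \<in> partitions n"
        using adj f[OF p(1)] by (auto simp: partition_adj_def)
      fix v :: nat
      assume "1 \<le> v"
      then show "parts_ge ys v = parts_ge (f p) v"
        using p(2) f[OF p(1)] unfolding unit_shift_def by (metis of_nat_eq_iff)
    qed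
    with p(1) show "ys \<in> f ` transfer_pairs xs" by blast
  qed (use f in auto)
  ultimately show ?thesis
    unfolding partition_deg_def by (metis card_image)
qed

section \<open>The number of pairs\<close>

lemma card_transfer_pairs_le:
  "card (transfer_pairs xs) \<le> card (set xs) * Suc (card (set xs))"
proof -
  have "card (transfer_pairs xs) \<le> card (set xs \<times> insert 0 (set xs))"
    by (rule card_mono) (auto simp: transfer_pairs_def)
  also have "\<dots> \<le> card (set xs) * Suc (card (set xs))"
    by (simp add: card_cartesian_product card_insert_if)
  finally show ?thesis .
qed

text \<open>
  From all of \<open>D \<times> (D \<union> {0})\<close>, where \<open>D\<close> is the set of part sizes, two kinds of pairs are excluded:
  \<open>(a, a - 1)\<close>, and \<open>(a, a)\<close> for a size \<open>a\<close> that occurs only once.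
\<close>

lemma card_transfer_pairs:
  assumes "0 \<notin> set xs"
  shows "card (transfer_pairs xs)
      + card {a \<in> set xs. a - 1 \<in> insert 0 (set xs)} + card {a \<in> set xs. count (mset xs) a = 1}
    = card (set xs) * Suc (card (set xs))"
proof -
  let ?C = "{a \<in> set xs. a - 1 \<in> insert 0 (set xs)}"
  let ?S = "{a \<in> set xs. count (mset xs) a = 1}"
  let ?f = "\<lambda>a::nat. (a, a - 1)" and ?g = "\<lambda>a::nat. (a, a)"
  have ge2: "2 \<le> count (mset xs) a \<longleftrightarrow> count (mset xs) a \<noteq> 1" if "a \<in> set xs" for a
  proof -
    have "0 < count (mset xs) a" using that by (simp add: count_greater_zero_iff)
    then show ?thesis by linarith
  qed
  have pred: "a = Suc b \<longleftrightarrow> b = a - 1" if "a \<in> set xs" for a b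
    using that assms by (metis Suc_pred' diff_Suc_1 gr0I)
  have "set xs \<times> insert 0 (set xs) = transfer_pairs xs \<union> ?f ` ?C \<union> ?g ` ?S"
    unfolding transfer_pairs_def using ge2 pred by (auto simp: image_iff)
  moreover have "transfer_pairs xs \<inter> ?f ` ?C = {}"
    by (auto simp: transfer_pairs_def pred)
  moreover have "(transfer_pairs xs \<union> ?f ` ?C) \<inter> ?g ` ?S = {}"
  proof -
    have "a \<noteq> a - 1" if "a \<in> set xs" for a
      using that assms by (cases "a = 0") auto
    then show ?thesis
      by (auto simp: transfer_pairs_def)
  qed
  moreover have "finite (transfer_pairs xs)"
    by (rule finite_subset[of _ "set xs \<times> insert 0 (set xs)"]) (auto simp: transfer_pairs_def)
  ultimately have "card (set xs \<times> insert 0 (set xs))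
      = card (transfer_pairs xs) + card (?f ` ?C) + card (?g ` ?S)"
    by (simp add: card_Un_disjoint)
  moreover have "card (?f ` ?C) = card ?C" "card (?g ` ?S) = card ?S"
    by (auto intro!: card_image inj_onI)
  ultimately show ?thesis
    using assms by (simp add: card_cartesian_product)
qed

section \<open>Sets of positive integers with small sum\<close>

lemma triangular_0: "triangular 0 = 0"
  by (simp add: triangular_def)

lemma triangular_Suc: "triangular (Suc t) = triangular t + Suc t"
  by (simp add: triangular_def)

lemma sum_atLeastAtMost_eq_triangular: "\<Sum> {1..t} = triangular t"
  by (induction t) (simp_all add: triangular_0 triangular_Suc)

lemma Max_ge_card:
  fixes D :: "nat set"
  assumes "finite D" "0 \<notin> D" "D \<noteq> {}"
  shows "card D \<le> Max D" and "Max D = card D \<Longrightarrow> D = {1..card D}"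
proof -
  have sub: "D \<subseteq> {1..Max D}"
    using assms by (auto simp: Suc_le_eq intro: gr0I)
  show "card D \<le> Max D"
    using card_mono[OF _ sub] by simp
  show "D = {1..card D}" if "Max D = card D"
    using card_subset_eq[OF _ sub] that by (metis card_atLeastAtMost diff_Suc_1 finite_atLeastAtMost)
qed

lemma sum_remove_Max:
  fixes D :: "nat set"
  assumes "finite D" "0 \<notin> D" "card D = Suc t"
  shows "\<Sum> D = Max D + \<Sum> (D - {Max D})" "card (D - {Max D}) = t" "Suc t \<le> Max D"
proof -
  have ne: "D \<noteq> {}" using assms(3) by auto
  show "\<Sum> D = Max D + \<Sum> (D - {Max D})"
    using sum.remove[OF assms(1) Max_in[OF assms(1) ne], of "\<lambda>x. x"] by simp
  show "card (D - {Max D}) = t"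
    using assms ne by simp
  show "Suc t \<le> Max D"
    using Max_ge_card(1)[OF assms(1,2) ne] assms(3) by simp
qed

lemma triangular_le_sum:
  fixes D :: "nat set"
  assumes "finite D" "0 \<notin> D"
  shows "triangular (card D) \<le> \<Sum> D"
  using assms
proof (induction "card D" arbitrary: D)
  case 0
  then show ?case by (simp add: triangular_0)
next
  case (Suc t)
  note r = sum_remove_Max[OF Suc.prems Suc.hyps(2)[symmetric]]
  have "triangular t \<le> \<Sum> (D - {Max D})"
    using Suc.hyps(1)[of "D - {Max D}"] Suc.prems r(2) by simp
  then have "triangular (Suc t) \<le> \<Sum> D"
    using r(1,3) unfolding triangular_Suc by linarith
  then show ?case
    using Suc.hyps(2) by metis
qed

lemma triangular_le_sum_remove_Max:
  fixes D :: "nat set"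
  assumes "finite D" "0 \<notin> D" "card D = Suc t"
  shows "triangular t \<le> \<Sum> (D - {Max D})"
  using triangular_le_sum[of "D - {Max D}"] assms sum_remove_Max(2)[OF assms] by simp

lemma sum_eq_triangular_imp:
  fixes D :: "nat set"
  assumes "finite D" "0 \<notin> D" "\<Sum> D = triangular (card D)"
  shows "D = {1..card D}"
proof (cases "card D")
  case 0
  then show ?thesis using assms(1) by simp
next
  case (Suc t)
  then have "D \<noteq> {}" by auto
  moreover have "Max D = card D"
    using sum_remove_Max[OF assms(1,2) Suc] triangular_le_sum_remove_Max[OF assms(1,2) Suc] assms(3) Suc
    by (simp add: triangular_Suc)
  ultimately show ?thesis
    using Max_ge_card(2)[OF assms(1,2)] by blast
qed

lemma sum_eq_triangular_plus_1_imp: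
  fixes D :: "nat set"
  assumes "finite D" "0 \<notin> D" "\<Sum> D = triangular (card D) + 1"
  shows "D = insert (card D + 1) {1..<card D}"
proof (cases "card D")
  case 0
  then show ?thesis using assms by (simp add: triangular_0)
next
  case (Suc t)
  note b = sum_remove_Max[OF assms(1,2) Suc] triangular_le_sum_remove_Max[OF assms(1,2) Suc]
  have ne: "D \<noteq> {}" using Suc by auto
  have "Max D \<noteq> card D"
  proof
    assume "Max D = card D"
    then have "D = {1..card D}"
      using Max_ge_card(2)[OF assms(1,2) ne] by blast
    then have "\<Sum> D = triangular (card D)"
      by (metis sum_atLeastAtMost_eq_triangular)
    with assms(3) show False by simp
  qed
  then have Max: "Max D = card D + 1" and "\<Sum> (D - {Max D}) = triangular t"
    using b assms(3) Suc by (auto simp: triangular_Suc)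
  then have "D - {Max D} = {1..t}"
    using sum_eq_triangular_imp[of "D - {Max D}"] assms b(2) by simp
  moreover have "D = insert (Max D) (D - {Max D})"
    using Max_in[OF assms(1) ne] by blast
  ultimately show ?thesis
    using Max Suc by (metis atLeastLessThanSuc_atLeastAtMost)
qed

section \<open>Partitions with the largest number of distinct parts\<close>

lemma mset_positive_sum_0:
  fixes M :: "nat multiset"
  assumes "0 \<notin># M" "sum_mset M = 0"
  shows "M = {#}"
proof (rule ccontr)
  assume "M \<noteq> {#}"
  then obtain x where "x \<in># M" by blast
  with assms show False by auto
qed

lemma mset_positive_sum_1:
  fixes M :: "nat multiset"
  assumes "0 \<notin># M" "sum_mset M = 1"
  shows "M = {#1#}"
proof (cases M)
  case empty
  then show ?thesis using assms(2) by simp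
next
  case (add x N)
  then have "0 < x" "x + sum_mset N = 1" "0 \<notin># N"
    using assms by auto
  then have "x = 1" "sum_mset N = 0" "0 \<notin># N"
    by linarith+
  with add show ?thesis using mset_positive_sum_0[of N] by simp
qed

lemma mset_staircase: "mset (staircase t) = mset_set {1..t}"
  by (simp add: staircase_def atLeastLessThanSuc_atLeastAtMost del: upt_Suc)

lemma mset_delta_bot: "mset (delta_bot t) = add_mset 1 (mset_set {1..t})"
  by (simp add: delta_bot_def mset_staircase)

lemma mset_delta_top: "1 \<le> t \<Longrightarrow> mset (delta_top t) = add_mset (t + 1) (mset_set {1..<t})"
  by (simp add: delta_top_eq)

lemma delta_bot_in_partitions: "delta_bot t \<in> partitions (triangular t + 1)"
proof -
  have "sum_list (delta_bot t) = triangular t + 1"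
    using mset_delta_bot[of t]
    by (metis add.commute sum_atLeastAtMost_eq_triangular sum_mset.add_mset sum_mset_sum_list
        sum_unfold_sum_mset multiset.map_ident)
  then show ?thesis
    by (auto simp: partitions_def delta_bot_eq sorted_wrt_append sorted_wrt_rev simp del: upt_Suc)
qed

lemma delta_top_in_partitions:
  assumes "1 \<le> t"
  shows "delta_top t \<in> partitions (triangular t + 1)"
proof -
  obtain s where s: "t = Suc s" using assms by (cases t) auto
  have "sum_list (delta_top t) = t + 1 + \<Sum> {1..s}"
    using mset_delta_top[OF assms]
    by (metis s atLeastLessThanSuc_atLeastAtMost sum_mset.add_mset sum_mset_sum_list
        sum_unfold_sum_mset multiset.map_ident)
  then have "sum_list (delta_top t) = triangular t + 1"
    by (simp only: sum_atLeastAtMost_eq_triangular) (simp add: s triangular_Suc)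
  then show ?thesis
    using assms by (auto simp: partitions_def delta_top_eq sorted_wrt_rev simp del: upt_Suc)
qed

text \<open>
  The sum of a partition splits into the sum of its distinct part sizes and the sum of the multiset
  \<open>M\<close> of repetitions. With at least \<open>t\<close> sizes, the former is at least \<open>triangular t\<close>, so the latter is
  \<open>0\<close> or \<open>1\<close>.
\<close>

lemma card_set_less_or_delta:
  assumes xs: "xs \<in> partitions (triangular t + 1)" and t: "1 \<le> t"
  shows "card (set xs) < t \<or> xs = delta_top t \<or> xs = delta_bot t"
proof -
  define D where "D = set xs"
  have D: "finite D" "0 \<notin> D"
    using xs by (auto simp: D_def partitions_def)
  define M where "M = mset xs - mset_set D"
  have "mset_set D \<subseteq># mset xs"
    by (simp add: D_def mset_set_set_mset_msubset flip: set_mset_mset)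
  then have xs_eq: "mset xs = mset_set D + M"
    by (simp add: M_def)
  then have M0: "0 \<notin># M"
    using D(2) by (metis D_def set_mset_mset union_iff)
  have total: "\<Sum> D + sum_mset M = triangular t + 1"
    using xs arg_cong[OF xs_eq, of sum_mset]
    by (simp add: partitions_def sum_mset_sum_list sum_unfold_sum_mset)
  have ge: "triangular (card D) \<le> \<Sum> D"
    using triangular_le_sum[OF D] .
  have mono: "triangular (Suc t) \<le> triangular m" if "t < m" for m
    unfolding triangular_def using that by (intro div_le_mono mult_le_mono) auto
  have "card D \<le> t"
  proof (rule ccontr)
    assume "\<not> card D \<le> t"
    then show False
      using mono[of "card D"] ge total t by (simp add: triangular_Suc)
  qed
  then consider "card D < t" | "card D = t" "sum_mset M = 0" | "card D = t" "sum_mset M = 1"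
    using ge total by fastforce
  then show ?thesis
  proof cases
    case 1
    then show ?thesis by (simp add: D_def)
  next
    case 2
    then have "\<Sum> D = triangular (card D) + 1"
      using total 2 by simp
    then have "D = insert (t + 1) {1..<t}"
      using sum_eq_triangular_plus_1_imp[OF D] 2(1) by blast
    then have "mset xs = mset (delta_top t)"
      using xs_eq mset_positive_sum_0[OF M0 2(2)] t by (simp add: mset_delta_top)
    then show ?thesis
      using partition_eqI_mset[OF xs delta_top_in_partitions[OF t]] by simp
  next
    case 3
    then have "\<Sum> D = triangular (card D)"
      using total 3 by simp
    then have "D = {1..t}"
      using sum_eq_triangular_imp[OF D] 3(1) by blast
    then have "mset xs = mset (delta_bot t)"
      using xs_eq mset_positive_sum_1[OF M0 3(2)] by (simp add: mset_delta_bot)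
    then show ?thesis
      using partition_eqI_mset[OF xs delta_bot_in_partitions] by simp
  qed
qed

section \<open>Degrees of the two extremal partitions\<close>

lemma card_transfer_pairs_delta_bot:
  assumes "1 \<le> t"
  shows "card (transfer_pairs (delta_bot t)) = t * (t - 1) + 1"
proof -
  have set: "set (delta_bot t) = {1..t}"
    using assms mset_delta_bot[of t] by (metis atLeastAtMost_iff finite_atLeastAtMost
        finite_set_mset_mset_set insert_absorb order_refl set_mset_add_mset_insert set_mset_mset)
  have "{a \<in> {1..t}. a - 1 \<in> insert 0 {1..t}} = {1..t}"
    by auto
  moreover have "{a \<in> {1..t}. count (mset (delta_bot t)) a = 1} = {2..t}"
    using assms by (auto simp: mset_delta_bot count_mset_set split: if_splits)
  ultimately have "card (transfer_pairs (delta_bot t)) + t + (t - 1) = t * Suc t"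
    using card_transfer_pairs[of "delta_bot t"] by (simp add: set)
  then show ?thesis
    using assms by (cases t) (auto simp: algebra_simps)
qed

lemma card_transfer_pairs_delta_top:
  assumes "1 < t"
  shows "card (transfer_pairs (delta_top t)) = t * (t - 1) + 1"
proof -
  let ?D = "insert (t + 1) {1..<t}"
  have set: "set (delta_top t) = ?D"
    using assms by (simp add: delta_top_eq)
  have card: "card ?D = t"
    using assms by simp
  have "{a \<in> ?D. a - 1 \<in> insert 0 ?D} = {1..<t}"
    using assms by auto
  moreover have "{a \<in> ?D. count (mset (delta_top t)) a = 1} = ?D"
    using assms by (auto simp: mset_delta_top count_mset_set)
  moreover have "0 \<notin> ?D" by simp
  ultimately have "card (transfer_pairs (delta_top t)) + card {1..<t} + card ?D = t * Suc t"
    using card_transfer_pairs[of "delta_top t"] unfolding set card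
    by (simp only: simp_thms card)
  then have "card (transfer_pairs (delta_top t)) + (t - 1) + t = t * Suc t"
    unfolding card by simp
  then show ?thesis
    using assms by (cases t) (auto simp: algebra_simps)
qed

lemma partition_deg_less:
  assumes "xs \<in> partitions n" "card (set xs) < t"
  shows "partition_deg n xs < t * (t - 1) + 1"
proof -
  have "partition_deg n xs \<le> card (set xs) * Suc (card (set xs))"
    using partition_deg_eq_card_transfer_pairs[OF assms(1)] card_transfer_pairs_le by simp
  also have "\<dots> \<le> (t - 1) * t"
    using assms(2) by (intro mult_le_mono) auto
  finally show ?thesis by (simp add: mult.commute)
qed

theorem theorem3p11:
  fixes t n :: nat
  assumes "t \<ge> 2" and "n = triangular t + 1"
  shows "max_partition_deg n = t * (t - 1) + 1 \<and>
         MaxDeg n = {delta_top t, delta_bot t} \<and>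
         m_Delta n = 2"
proof -
  let ?m = "t * (t - 1) + 1"
  have t: "1 \<le> t" "1 < t" using assms(1) by auto
  have top: "delta_top t \<in> partitions n" and bot: "delta_bot t \<in> partitions n"
    using delta_top_in_partitions[OF t(1)] delta_bot_in_partitions assms(2) by auto
  have deg_top: "partition_deg n (delta_top t) = ?m"
    using partition_deg_eq_card_transfer_pairs[OF top] card_transfer_pairs_delta_top[OF t(2)] by simp
  have deg_bot: "partition_deg n (delta_bot t) = ?m"
    using partition_deg_eq_card_transfer_pairs[OF bot] card_transfer_pairs_delta_bot[OF t(1)] by simp
  have other: "partition_deg n xs < ?m"
    if "xs \<in> partitions n" "xs \<noteq> delta_top t" "xs \<noteq> delta_bot t" for xs
    using card_set_less_or_delta[of xs t] partition_deg_less that t(1) assms(2) by blast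
  have max: "max_partition_deg n = ?m"
    unfolding max_partition_deg_def
  proof (rule Max_eqI)
    show "finite (partition_deg n ` partitions n)"
      using finite_partitions by simp
    show "y \<le> ?m" if "y \<in> partition_deg n ` partitions n" for y
      using that other deg_top deg_bot by (metis imageE less_imp_le order_refl)
    show "?m \<in> partition_deg n ` partitions n"
      using deg_top top by (metis imageI)
  qed
  have MaxDeg: "MaxDeg n = {delta_top t, delta_bot t}"
    using top bot deg_top deg_bot other unfolding MaxDeg_def max by fastforce
  have "length (delta_top t) \<noteq> length (delta_bot t)"
    by (simp add: delta_top_def delta_bot_def)
  then have "delta_top t \<noteq> delta_bot t" by metis
  then have "m_Delta n = 2"
    by (simp add: m_Delta_def MaxDeg)
  with max MaxDeg show ?thesis by blast
qed

end
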